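(* Let $\mathbb M$ be a nonempty finite index set, $M\ge1$ an integer, $\delta t>0$, $T=M\,\delta t$, $E\in\mathbb R$, and let real constants $L_{\tau,m}<U_{\tau,m}$ ($\tau\in\{0,1\}$, $m\in\mathbb M$) and $\sigma\ge1$ be given. Define the finite set of matrices $$\mathbb V=\Big\{(\upsilon_{m,k})_{m\in\mathbb M,\,1\le k\le M}\in\{0,1\}^{|\mathbb M|\times M}:\ \sum_{m\in\mathbb M}\upsilon_{m,k}=1\ \ \forall\,1\le k\le M\Big\},$$ and write its elements as $\upsilon^s=(\upsilon^s_{m,k})$, indexed by $s$. If the uncertainty set $\hat{\boldsymbol\eta}_b$ (defined in the context) has nonempty interior, then the semi-infinite constraint $$\delta t\sum_{k=1}^M\max_{m\in\mathbb M}\left\{b_{1,m}^k N^k+b_{0,m}^k\right\}\le E\qquad\forall\,\hat{\boldsymbol b}=(b_{\tau,m}^k)\in\hat{\boldsymbol\eta}_b$$ on the vector $(N^k)_{1\le k\le M}$ of real numbers is equivalent to the following finite set of linear constraints: a vector $(N^k)_{1\le k\le M}$ satisfies the semi-infinite constraint if and only if for every $\upsilon^s\in\mathbb V$ there exist real numbers $\beta_{0,m}^{s,k},\gamma_{0,m}^{s,k},\beta_{1,m}^{s,k},\gamma_{1,m}^{s,k}$ ($m\in\mathbb M$, $1\le k\le M$) and $\theta^s$ such that $$\sum_{m\in\mathbb M}\sum_{k=1}^M\left(-L_{1,m}\gamma_{1,m}^{s,k}+U_{1,m}\beta_{1,m}^{s,k}+U_{0,m}\beta_{0,m}^{s,k}-L_{0,m}\gamma_{0,m}^{s,k}\right)+\frac{M\sum_{m\in\mathbb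 M}U_{1,m}}{\sigma}\,\theta^s\le E,$$ $$-\gamma_{1,m}^{s,k}+\beta_{1,m}^{s,k}+\theta^s=N^k\upsilon^s_{m,k}\,\delta t\qquad\forall\,1\le k\le M,\ m\in\mathbb M,$$ $$-\gamma_{0,m}^{s,k}+\beta_{0,m}^{s,k}=\upsilon^s_{m,k}\,\delta t\qquad\forall\,1\le k\le M,\ m\in\mathbb M,$$ $$\gamma_{1,m}^{s,k}\ge0,\ \beta_{1,m}^{s,k}\ge0,\ \gamma_{0,m}^{s,k}\ge0,\ \beta_{0,m}^{s,k}\ge0\qquad\forall\,1\le k\le M,\ m\in\mathbb M,\qquad \theta^s\ge0.$$
   Context: $N^k$ is the (link) occupancy at the $k$-th of $M$ time steps of size $\delta t$; $T=M\,\delta t$ is the length of the time horizon; $E$ is a prescribed bound; $\mathbb M$ indexes the affine pieces of a convex piecewise affine function. The uncertainty set is $$\hat{\boldsymbol\eta}_b=\Big\{\hat{\boldsymbol b}=(b_{\tau,m}^k)_{\tau\in\{0,1\},\,1\le k\le M,\,m\in\mathbb M}:\ L_{\tau,m}\le b_{\tau,m}^k\le U_{\tau,m}\ \ \forall\,\tau\in\{0,1\},\,1\le k\le M,\,m\in\mathbb M;\ \ \sum_{m\in\mathbb M}\delta t\sum_{k=1}^M b_{1,m}^k\le\frac{T\sum_{m\in\mathbb M}U_{1,m}}{\sigma}\Big\},$$ viewed as a subset of $\mathbb R^{2|\mathbb M|M}$. *)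

theory Defs
  imports "HOL-Analysis.Analysis"
begin

text \<open>
  The number \<open>M\<close> of time steps is a natural number and the index set \<open>P\<close> of the affine pieces
  is a finite set, so vectors are functions on explicit finite index sets.  A point of
  \<open>\<real>\<^sup>2\<^sup>|\<^sup>P\<^sup>|\<^sup>M\<close> is an extensional function on \<open>box_index P M\<close>; the entry written
  \<open>b\<^sub>\<tau>\<^sub>,\<^sub>m\<close> with upper index \<open>k\<close> is \<open>b (\<tau>, k, m)\<close>.
\<close>

definition box_index :: "'m set \<Rightarrow> nat \<Rightarrow> (nat \<times> nat \<times> 'm) set" where
  "box_index P M = {0, 1} \<times> {1..M} \<times> P"

text \<open>For finite \<open>P\<close> the product topology on the finitely many real coordinates is the
  Euclidean topology.  Its carrier is \<open>box_index P M \<rightarrow>\<^sub>E UNIV\<close>.\<close>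

definition box_topology :: "'m set \<Rightarrow> nat \<Rightarrow> (nat \<times> nat \<times> 'm \<Rightarrow> real) topology" where
  "box_topology P M = product_topology (\<lambda>_. euclideanreal) (box_index P M)"

definition uncertainty_set ::
  "'m set \<Rightarrow> nat \<Rightarrow> real \<Rightarrow> real \<Rightarrow> (nat \<Rightarrow> 'm \<Rightarrow> real) \<Rightarrow> (nat \<Rightarrow> 'm \<Rightarrow> real) \<Rightarrow> real
    \<Rightarrow> (nat \<times> nat \<times> 'm \<Rightarrow> real) set" where
  "uncertainty_set P M dt T L U \<sigma> =
    {b \<in> box_index P M \<rightarrow>\<^sub>E UNIV.
       (\<forall>\<tau>\<in>{0, 1}. \<forall>k\<in>{1..M}. \<forall>m\<in>P. L \<tau> m \<le> b (\<tau>, k, m) \<and> b (\<tau>, k, m) \<le> U \<tau> m) \<and>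
       (\<Sum>m\<in>P. dt * (\<Sum>k=1..M. b (1, k, m))) \<le> T * (\<Sum>m\<in>P. U 1 m) / \<sigma>}"

definition selection_matrices :: "'m set \<Rightarrow> nat \<Rightarrow> ('m \<times> nat \<Rightarrow> real) set" where
  "selection_matrices P M =
    {\<upsilon> \<in> P \<times> {1..M} \<rightarrow>\<^sub>E {0, 1}. \<forall>k\<in>{1..M}. (\<Sum>m\<in>P. \<upsilon> (m, k)) = 1}"

lemma finite_selection_matrices:
  assumes "finite P"
  shows "finite (selection_matrices P M)"
  unfolding selection_matrices_def using assms by (simp add: finite_PiE)

end

theory Submission
  imports Defs
begin

text \<open>
  A sum of maxima over \<open>P\<close> is the largest of the sums obtained by selecting one piece of
  \<open>P\<close> for each time step, so it is the maximum over the selection matrices \<open>\<upsilon>\<close> of an expression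
  that is linear in \<open>b\<close> (lemma \<open>sum_Max_le_iff_all_selections\<close>).  Hence the semi-infinite
  constraint says that, for every \<open>\<upsilon>\<close> separately, the value of a linear program over the
  uncertainty set is at most \<open>E\<close>.  The finite system attached to \<open>\<upsilon>\<close> says that the dual of this
  program has a feasible point of value at most \<open>E\<close>, so the theorem is linear programming duality,
  together with attainment on both sides.

  The general duality theorem can be bypassed, because the linear program is a continuous
  knapsack problem: apart from box constraints there is a single budget constraint on the entries
  \<open>b (1, k, m)\<close>, while each entry \<open>b (0, k, m)\<close> has a nonnegative objective coefficient
  and can be put at its upper bound.  For such a program a primal and a dual point of equal value
  can be written down (lemma \<open>knapsack_strong_duality\<close>): the price \<open>\<theta>\<close> of the budget is a
  threshold, items whose coefficient exceeds \<open>\<theta>\<close> are filled to the upper bound, items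
  below \<open>\<theta>\<close> are left at the lower bound, and for \<open>\<theta> > 0\<close> the items at the threshold absorb
  the rest of the budget, whereas a budget of price \<open>0\<close> need not be spent.  The nonempty interior enters by making the linear program feasible.
\<close>

section \<open>Duality for a linear program with box constraints and one budget constraint\<close>

lemma box_weak_duality:
  fixes \<beta> \<gamma> l u x :: real
  assumes "\<beta> \<ge> 0" "\<gamma> \<ge> 0" "l \<le> x" "x \<le> u"
  shows "(\<beta> - \<gamma>) * x \<le> u * \<beta> - l * \<gamma>"
proof -
  have "\<beta> * x \<le> \<beta> * u" "\<gamma> * l \<le> \<gamma> * x"
    using assms by (auto intro: mult_left_mono)
  then show ?thesis by (simp add: algebra_simps)
qed

lemma knapsack_weak_duality:
  fixes c l u x \<beta> \<gamma> :: "'i \<Rightarrow> real" and R \<theta> :: real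
  assumes box: "\<And>i. i \<in> I \<Longrightarrow> l i \<le> x i \<and> x i \<le> u i"
    and budget: "sum x I \<le> R"
    and dual: "\<And>i. i \<in> I \<Longrightarrow> - \<gamma> i + \<beta> i + \<theta> = c i"
    and nonneg: "\<And>i. i \<in> I \<Longrightarrow> \<beta> i \<ge> 0 \<and> \<gamma> i \<ge> 0" "\<theta> \<ge> 0"
  shows "(\<Sum>i\<in>I. c i * x i) \<le> (\<Sum>i\<in>I. u i * \<beta> i - l i * \<gamma> i) + R * \<theta>"
proof -
  have "(\<Sum>i\<in>I. c i * x i) \<le> (\<Sum>i\<in>I. (u i * \<beta> i - l i * \<gamma> i) + \<theta> * x i)"
  proof (rule sum_mono)
    fix i assume i: "i \<in> I"
    have "c i * x i = (\<beta> i - \<gamma> i) * x i + \<theta> * x i"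
      unfolding dual[OF i, symmetric] by (simp add: algebra_simps)
    then show "c i * x i \<le> (u i * \<beta> i - l i * \<gamma> i) + \<theta> * x i"
      using box_weak_duality[of "\<beta> i" "\<gamma> i" "l i" "x i" "u i"] box[OF i] nonneg(1)[OF i] by simp
  qed
  also have "\<dots> = (\<Sum>i\<in>I. u i * \<beta> i - l i * \<gamma> i) + \<theta> * sum x I"
    by (simp add: sum.distrib sum_distrib_left)
  also have "\<dots> \<le> (\<Sum>i\<in>I. u i * \<beta> i - l i * \<gamma> i) + R * \<theta>"
    using mult_left_mono[OF budget nonneg(2)] by (simp add: mult.commute)
  finally show ?thesis .
qed

text \<open>
  The greedy solution of the continuous knapsack problem and its threshold price.  The three
  conditions relating \<open>x\<close> to \<open>\<theta>\<close> are complementary slackness.  Filling exactly the items with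
  \<open>c i > t\<close> costs \<open>F t\<close>, which decreases in \<open>t\<close> and jumps only at values of \<open>c\<close>; the
  threshold is the first nonnegative \<open>t\<close> at which this cost is within the budget.
\<close>

lemma knapsack_threshold:
  fixes c l u :: "'i \<Rightarrow> real" and R :: real
  assumes fin: "finite I"
    and le: "\<And>i. i \<in> I \<Longrightarrow> l i \<le> u i"
    and feasible: "sum l I \<le> R"
  obtains x \<theta> where "\<theta> \<ge> 0"
    and "\<And>i. i \<in> I \<Longrightarrow> l i \<le> x i \<and> x i \<le> u i"
    and "sum x I \<le> R"
    and "\<And>i. i \<in> I \<Longrightarrow> c i > \<theta> \<Longrightarrow> x i = u i"
    and "\<And>i. i \<in> I \<Longrightarrow> c i < \<theta> \<Longrightarrow> x i = l i"
    and "\<theta> > 0 \<Longrightarrow> sum x I = R"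
proof -
  define f where "f t i = (if c i > t then u i else l i)" for t i
  define F where "F t = sum (f t) I" for t
  define C where "C = insert 0 {t \<in> c ` I. t > 0}"
  have C: "finite C" "0 \<in> C" "\<And>t. t \<in> C \<Longrightarrow> t \<ge> 0"
    using fin by (auto simp: C_def)
  \<comment> \<open>At the largest candidate nothing is filled, so the budget is met there.\<close>
  have "F (Max C) = sum l I"
    unfolding F_def
  proof (rule sum.cong)
    fix i assume i: "i \<in> I"
    have "c i \<le> Max C"
    proof (cases "c i > 0")
      case True
      then show ?thesis using i C by (auto simp: C_def)
    next
      case False
      then show ?thesis using Max_ge[OF C(1,2)] by linarith
    qed
    then show "f (Max C) i = l i" by (simp add: f_def)
  qed simp
  moreover have "Max C \<in> C" using C by (intro Max_in) auto
  ultimately have "Max C \<in> {t \<in> C. F t \<le> R}"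
    using feasible by simp
  moreover define \<theta> where "\<theta> = Min {t \<in> C. F t \<le> R}"
  ultimately have \<theta>: "\<theta> \<in> C" "F \<theta> \<le> R" and \<theta>_least: "\<And>t. t \<in> C \<Longrightarrow> F t \<le> R \<Longrightarrow> \<theta> \<le> t"
    using Min_in[of "{t \<in> C. F t \<le> R}"] C by auto
  show thesis
  proof (cases "\<theta> > 0")
    case False
    then have "\<theta> = 0" using C(3)[OF \<theta>(1)] by linarith
    then show thesis
      using that[of \<theta> "f \<theta>"] \<theta>(2) le by (auto simp: f_def F_def)
  next
    case True
    \<comment> \<open>Filling the items at the threshold as well is what the preceding candidate prescribes,
      and that candidate exceeds the budget.\<close>
    define g where "g i = (if c i \<ge> \<theta> then u i else l i)" for i
    define s where "s = Max {t \<in> C. t < \<theta>}"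
    have "s \<in> {t \<in> C. t < \<theta>}"
      unfolding s_def by (rule Max_in) (use C True in auto)
    then have s: "s \<in> C" "s < \<theta>" by auto
    have s_max: "t \<le> s" if "t \<in> C" "t < \<theta>" for t
      unfolding s_def using that C by (intro Max_ge) auto
    have "c i > s \<longleftrightarrow> c i \<ge> \<theta>" if "i \<in> I" for i
    proof
      assume "c i > s"
      then have "c i \<in> C" using that C(3)[OF s(1)] by (auto simp: C_def)
      then show "c i \<ge> \<theta>" using s_max[of "c i"] \<open>c i > s\<close> by linarith
    qed (use s in linarith)
    then have "F s = sum g I"
      unfolding F_def f_def g_def by (intro sum.cong) auto
    then have g: "sum g I > R" using \<theta>_least[OF s(1)] s(2) by force
    \<comment> \<open>Between the two fillings, one convex combination spends the budget exactly.\<close>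
    define a where "a = (R - F \<theta>) / (sum g I - F \<theta>)"
    have a: "0 \<le> a" "a \<le> 1" "a * (sum g I - F \<theta>) = R - F \<theta>"
      using g \<theta>(2) by (auto simp: a_def field_simps)
    define x where "x i = f \<theta> i + a * (g i - f \<theta> i)" for i
    have "sum x I = F \<theta> + a * (sum g I - F \<theta>)"
      by (simp add: x_def F_def sum.distrib sum_subtractf flip: sum_distrib_left)
    then have sum_x: "sum x I = R" using a by simp
    have box: "l i \<le> x i \<and> x i \<le> u i" if "i \<in> I" for i
    proof -
      have "0 \<le> a * (u i - l i)" "a * (u i - l i) \<le> u i - l i"
        using a le[OF that] by (auto intro: mult_left_le_one_le)
      then show ?thesis using le[OF that] by (auto simp: x_def f_def g_def)
    qed
    have above: "x i = u i" if "c i > \<theta>" for i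
      using that by (simp add: x_def f_def g_def)
    have below: "x i = l i" if "c i < \<theta>" for i
      using that by (simp add: x_def f_def g_def)
    show thesis
    proof (rule that[of \<theta> x])
      show "0 \<le> \<theta>" "sum x I \<le> R" using True sum_x by auto
    qed (simp_all add: box above below sum_x)
  qed
qed

text \<open>
  For a fixed price \<open>\<theta>\<close> the cheapest dual multipliers of the box constraints are the positive and
  negative parts of \<open>c i - \<theta>\<close>.  With these, complementary slackness turns weak duality into an
  equality term by term.
\<close>

lemma knapsack_strong_duality:
  fixes c l u :: "'i \<Rightarrow> real" and R :: real
  assumes "finite I"
    and "\<And>i. i \<in> I \<Longrightarrow> l i \<le> u i"
    and "sum l I \<le> R"
  obtains x \<theta> where "\<theta> \<ge> 0"
    and "\<forall>i\<in>I. l i \<le> x i \<and> x i \<le> u i"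
    and "sum x I \<le> R"
    and "(\<Sum>i\<in>I. u i * max (c i - \<theta>) 0 - l i * max (\<theta> - c i) 0) + R * \<theta> = (\<Sum>i\<in>I. c i * x i)"
proof (rule knapsack_threshold[OF assms, of c])
  fix x \<theta>
  assume \<theta>: "\<theta> \<ge> 0"
    and box: "\<And>i. i \<in> I \<Longrightarrow> l i \<le> x i \<and> x i \<le> u i"
    and budget: "sum x I \<le> R"
    and above: "\<And>i. i \<in> I \<Longrightarrow> c i > \<theta> \<Longrightarrow> x i = u i"
    and below: "\<And>i. i \<in> I \<Longrightarrow> c i < \<theta> \<Longrightarrow> x i = l i"
    and tight: "\<theta> > 0 \<Longrightarrow> sum x I = R"
  have "u i * max (c i - \<theta>) 0 - l i * max (\<theta> - c i) 0 = c i * x i - \<theta> * x i" if "i \<in> I" for i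
    using above[OF that] below[OF that]
    by (cases "c i" \<theta> rule: linorder_cases) (auto simp: algebra_simps)
  then have "(\<Sum>i\<in>I. u i * max (c i - \<theta>) 0 - l i * max (\<theta> - c i) 0)
      = (\<Sum>i\<in>I. c i * x i) - \<theta> * sum x I"
    by (simp add: sum_subtractf sum_distrib_left)
  moreover have "\<theta> * sum x I = R * \<theta>"
    using tight \<theta> by (cases "\<theta> = 0") auto
  ultimately have "(\<Sum>i\<in>I. u i * max (c i - \<theta>) 0 - l i * max (\<theta> - c i) 0) + R * \<theta>
      = (\<Sum>i\<in>I. c i * x i)"
    by linarith
  with \<theta> box budget show thesis by (intro that) auto
qed

section \<open>Sums of maxima as maxima over selection matrices\<close>

lemma selection_nonneg:
  assumes "\<upsilon> \<in> selection_matrices P M" "m \<in> P" "k \<in> {1..M}"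
  shows "\<upsilon> (m, k) \<ge> 0"
proof -
  have "\<upsilon> (m, k) \<in> {0, 1}"
    using assms by (auto simp: selection_matrices_def PiE_iff)
  then show ?thesis by auto
qed

lemma selection_average_le_Max:
  fixes f :: "'m \<Rightarrow> real"
  assumes fin: "finite P" and \<upsilon>: "\<upsilon> \<in> selection_matrices P M" and k: "k \<in> {1..M}"
  shows "(\<Sum>m\<in>P. \<upsilon> (m, k) * f m) \<le> Max (f ` P)"
proof -
  have "(\<Sum>m\<in>P. \<upsilon> (m, k) * f m) \<le> (\<Sum>m\<in>P. \<upsilon> (m, k) * Max (f ` P))"
    using fin selection_nonneg[OF \<upsilon> _ k] by (intro sum_mono mult_left_mono) auto
  also have "\<dots> = Max (f ` P)"
    using \<upsilon> k by (simp add: selection_matrices_def flip: sum_distrib_right)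
  finally show ?thesis .
qed

lemma selection_attains_Max:
  fixes f :: "nat \<Rightarrow> 'm \<Rightarrow> real"
  assumes fin: "finite P" and ne: "P \<noteq> {}"
  obtains \<upsilon> where "\<upsilon> \<in> selection_matrices P M"
    and "\<And>k. k \<in> {1..M} \<Longrightarrow> (\<Sum>m\<in>P. \<upsilon> (m, k) * f k m) = Max (f k ` P)"
proof -
  have "\<exists>m\<in>P. f k m = Max (f k ` P)" for k
    using fin ne by (metis Max_in finite_imageI image_iff image_is_empty)
  then obtain h where h: "\<And>k. h k \<in> P" "\<And>k. f k (h k) = Max (f k ` P)"
    by metis
  define \<upsilon> :: "'m \<times> nat \<Rightarrow> real" where
    "\<upsilon> = restrict (\<lambda>(m, k). if m = h k then 1 else 0) (P \<times> {1..M})"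
  have eq: "(\<Sum>m\<in>P. \<upsilon> (m, k) * g m) = g (h k)" if "k \<in> {1..M}" for g k
  proof -
    have "(\<Sum>m\<in>P. \<upsilon> (m, k) * g m) = (\<Sum>m\<in>P. if m = h k then g m else 0)"
      using that by (intro sum.cong) (auto simp: \<upsilon>_def)
    then show ?thesis using fin h by simp
  qed
  have "\<upsilon> \<in> P \<times> {1..M} \<rightarrow>\<^sub>E {0, 1}"
    by (auto simp: \<upsilon>_def split: if_splits)
  then have "\<upsilon> \<in> selection_matrices P M"
    using eq[of _ "\<lambda>_. 1"] by (simp add: selection_matrices_def)
  then show thesis using that eq h by simp
qed

text \<open>
  Each column of a selection matrix averages the pieces at its time step, hence stays below their
  maximum; the matrix that selects a maximizer at every time step attains all maxima at once.
\<close>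

lemma sum_Max_le_iff_all_selections:
  fixes f :: "nat \<Rightarrow> 'm \<Rightarrow> real"
  assumes "finite P" and "P \<noteq> {}" and "dt \<ge> 0"
  shows "dt * (\<Sum>k=1..M. Max (f k ` P)) \<le> E \<longleftrightarrow>
    (\<forall>\<upsilon>\<in>selection_matrices P M. dt * (\<Sum>k=1..M. \<Sum>m\<in>P. \<upsilon> (m, k) * f k m) \<le> E)"
    (is "?L \<longleftrightarrow> ?R")
proof
  assume L: ?L
  show ?R
  proof
    fix \<upsilon> assume "\<upsilon> \<in> selection_matrices P M"
    then have "dt * (\<Sum>k=1..M. \<Sum>m\<in>P. \<upsilon> (m, k) * f k m) \<le> dt * (\<Sum>k=1..M. Max (f k ` P))"
      using assms by (intro mult_left_mono sum_mono selection_average_le_Max) auto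
    then show "dt * (\<Sum>k=1..M. \<Sum>m\<in>P. \<upsilon> (m, k) * f k m) \<le> E"
      using L by linarith
  qed
next
  assume R: ?R
  obtain \<upsilon> where "\<upsilon> \<in> selection_matrices P M"
    and "\<And>k. k \<in> {1..M} \<Longrightarrow> (\<Sum>m\<in>P. \<upsilon> (m, k) * f k m) = Max (f k ` P)"
    using selection_attains_Max[OF assms(1,2)] by blast
  then show ?L using R by (metis (no_types, lifting) sum.cong)
qed

section \<open>The robust counterpart\<close>

text \<open>
  Dividing the budget constraint by the step size \<open>dt\<close> replaces \<open>T = real M * dt\<close> by \<open>real M\<close>,
  which is why \<open>real M\<close> multiplies the price \<open>\<theta>\<close> in the dual.
\<close>

lemma uncertainty_set_iff:
  fixes dt :: real
  assumes "dt > 0" and "T = real M * dt"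
  shows "b \<in> uncertainty_set P M dt T L U \<sigma> \<longleftrightarrow>
    b \<in> box_index P M \<rightarrow>\<^sub>E UNIV \<and>
    (\<forall>\<tau>\<in>{0, 1}. \<forall>k\<in>{1..M}. \<forall>m\<in>P. L \<tau> m \<le> b (\<tau>, k, m) \<and> b (\<tau>, k, m) \<le> U \<tau> m) \<and>
    (\<Sum>m\<in>P. \<Sum>k=1..M. b (1, k, m)) \<le> real M * (\<Sum>m\<in>P. U 1 m) / \<sigma>"
proof -
  have "(\<Sum>m\<in>P. dt * (\<Sum>k=1..M. b (1, k, m))) = dt * (\<Sum>m\<in>P. \<Sum>k=1..M. b (1, k, m))"
    by (simp add: sum_distrib_left)
  moreover have "T * (\<Sum>m\<in>P. U 1 m) / \<sigma> = dt * (real M * (\<Sum>m\<in>P. U 1 m) / \<sigma>)"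
    using assms by simp
  ultimately show ?thesis
    using assms(1) by (simp only: uncertainty_set_def mem_Collect_eq mult_le_cancel_left_pos)
qed

text \<open>
  For a fixed selection matrix, weak duality gives one direction.  In the other, the entries
  \<open>b (0, k, m)\<close> take their upper bounds, as \<open>\<upsilon> (m, k) * dt\<close> is nonnegative, and the
  entries \<open>b (1, k, m)\<close> solve the knapsack problem with coefficients \<open>N k * \<upsilon> (m, k) * dt\<close>.
\<close>

lemma robust_linear_constraint_iff_dual:
  fixes P :: "'m set" and dt :: real and \<upsilon> :: "'m \<times> nat \<Rightarrow> real"
  assumes fin: "finite P" and dt: "dt > 0" and T: "T = real M * dt"
    and nonempty: "uncertainty_set P M dt T L U \<sigma> \<noteq> {}"
    and \<upsilon>: "\<And>m k. m \<in> P \<Longrightarrow> k \<in> {1..M} \<Longrightarrow> \<upsilon> (m, k) \<ge> 0"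
  shows "(\<forall>b\<in>uncertainty_set P M dt T L U \<sigma>.
        dt * (\<Sum>k=1..M. \<Sum>m\<in>P. \<upsilon> (m, k) * (b (1, k, m) * N k + b (0, k, m))) \<le> E)
     \<longleftrightarrow>
     (\<exists>(\<beta> :: nat \<Rightarrow> nat \<Rightarrow> 'm \<Rightarrow> real) (\<gamma> :: nat \<Rightarrow> nat \<Rightarrow> 'm \<Rightarrow> real) (\<theta> :: real).
          (\<Sum>m\<in>P. \<Sum>k=1..M. - L 1 m * \<gamma> 1 k m + U 1 m * \<beta> 1 k m
                              + U 0 m * \<beta> 0 k m - L 0 m * \<gamma> 0 k m)
            + real M * (\<Sum>m\<in>P. U 1 m) / \<sigma> * \<theta> \<le> E \<and>
          (\<forall>k\<in>{1..M}. \<forall>m\<in>P. - \<gamma> 1 k m + \<beta> 1 k m + \<theta> = N k * \<upsilon> (m, k) * dt) \<and>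
          (\<forall>k\<in>{1..M}. \<forall>m\<in>P. - \<gamma> 0 k m + \<beta> 0 k m = \<upsilon> (m, k) * dt) \<and>
          (\<forall>k\<in>{1..M}. \<forall>m\<in>P. \<gamma> 1 k m \<ge> 0 \<and> \<beta> 1 k m \<ge> 0 \<and> \<gamma> 0 k m \<ge> 0 \<and> \<beta> 0 k m \<ge> 0) \<and>
          \<theta> \<ge> 0)"
    (is "?primal \<longleftrightarrow> ?dual")
proof -
  define I where "I = P \<times> {1..M}"
  define R where "R = real M * (\<Sum>m\<in>P. U 1 m) / \<sigma>"
  define c where "c = (\<lambda>(m, k). N k * \<upsilon> (m, k) * dt)"
  have finI: "finite I" using fin by (simp add: I_def)
  note set_iff = uncertainty_set_iff[OF dt T, where P = P and L = L and U = U and \<sigma> = \<sigma>]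
  have budget: "(\<Sum>(m, k)\<in>I. b (1, k, m)) \<le> R"
    and box: "\<And>\<tau> m k. \<tau> \<in> {0, 1} \<Longrightarrow> (m, k) \<in> I \<Longrightarrow> L \<tau> m \<le> b (\<tau>, k, m) \<and> b (\<tau>, k, m) \<le> U \<tau> m"
    if "b \<in> uncertainty_set P M dt T L U \<sigma>" for b
    using that by (auto simp: set_iff I_def R_def sum.cartesian_product)
  have objective: "dt * (\<Sum>k=1..M. \<Sum>m\<in>P. \<upsilon> (m, k) * (b (1, k, m) * N k + b (0, k, m)))
      = (\<Sum>i\<in>I. c i * b (1, snd i, fst i)) + (\<Sum>(m, k)\<in>I. \<upsilon> (m, k) * dt * b (0, k, m))"
    for b :: "nat \<times> nat \<times> 'm \<Rightarrow> real"
  proof -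
    have "(\<Sum>k=1..M. \<Sum>m\<in>P. \<upsilon> (m, k) * (b (1, k, m) * N k + b (0, k, m)))
        = (\<Sum>(m, k)\<in>I. \<upsilon> (m, k) * (b (1, k, m) * N k + b (0, k, m)))"
      unfolding I_def by (subst sum.swap) (simp add: sum.cartesian_product)
    then have "dt * (\<Sum>k=1..M. \<Sum>m\<in>P. \<upsilon> (m, k) * (b (1, k, m) * N k + b (0, k, m)))
        = dt * (\<Sum>(m, k)\<in>I. \<upsilon> (m, k) * (b (1, k, m) * N k + b (0, k, m)))"
      by (rule arg_cong)
    also have "\<dots> = (\<Sum>i\<in>I. c i * b (1, snd i, fst i) + (case i of (m, k) \<Rightarrow> \<upsilon> (m, k) * dt * b (0, k, m)))"
      unfolding sum_distrib_left by (intro sum.cong) (auto simp: c_def algebra_simps)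
    finally show ?thesis by (simp only: sum.distrib)
  qed
  have dual_objective: "(\<Sum>m\<in>P. \<Sum>k=1..M. - L 1 m * \<gamma> 1 k m + U 1 m * \<beta> 1 k m
                              + U 0 m * \<beta> 0 k m - L 0 m * \<gamma> 0 k m)
      = (\<Sum>i\<in>I. U 1 (fst i) * \<beta> 1 (snd i) (fst i) - L 1 (fst i) * \<gamma> 1 (snd i) (fst i))
        + (\<Sum>(m, k)\<in>I. U 0 m * \<beta> 0 k m - L 0 m * \<gamma> 0 k m)"
    for \<beta> \<gamma> :: "nat \<Rightarrow> nat \<Rightarrow> 'm \<Rightarrow> real"
    unfolding I_def sum.cartesian_product sum.distrib[symmetric]
    by (intro sum.cong) auto
  show ?thesis
  proof
    assume ?dual
    then obtain \<beta> \<gamma> :: "nat \<Rightarrow> nat \<Rightarrow> 'm \<Rightarrow> real" and \<theta> :: real where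
      bound: "(\<Sum>m\<in>P. \<Sum>k=1..M. - L 1 m * \<gamma> 1 k m + U 1 m * \<beta> 1 k m
                              + U 0 m * \<beta> 0 k m - L 0 m * \<gamma> 0 k m) + R * \<theta> \<le> E"
      and eqs: "\<forall>k\<in>{1..M}. \<forall>m\<in>P. - \<gamma> 1 k m + \<beta> 1 k m + \<theta> = N k * \<upsilon> (m, k) * dt"
        "\<forall>k\<in>{1..M}. \<forall>m\<in>P. - \<gamma> 0 k m + \<beta> 0 k m = \<upsilon> (m, k) * dt"
      and signs: "\<forall>k\<in>{1..M}. \<forall>m\<in>P. \<gamma> 1 k m \<ge> 0 \<and> \<beta> 1 k m \<ge> 0 \<and> \<gamma> 0 k m \<ge> 0 \<and> \<beta> 0 k m \<ge> 0"
      and \<theta>: "\<theta> \<ge> 0"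
      unfolding R_def by blast
    have eq1: "- \<gamma> 1 k m + \<beta> 1 k m + \<theta> = c (m, k)"
      and eq0: "- \<gamma> 0 k m + \<beta> 0 k m = \<upsilon> (m, k) * dt"
      and nonneg: "\<gamma> 1 k m \<ge> 0 \<and> \<beta> 1 k m \<ge> 0 \<and> \<gamma> 0 k m \<ge> 0 \<and> \<beta> 0 k m \<ge> 0"
      if "(m, k) \<in> I" for m k
      using eqs signs that by (simp_all add: I_def c_def)
    show ?primal
    proof
      fix b assume b: "b \<in> uncertainty_set P M dt T L U \<sigma>"
      have "(\<Sum>i\<in>I. c i * b (1, snd i, fst i))
          \<le> (\<Sum>i\<in>I. U 1 (fst i) * \<beta> 1 (snd i) (fst i) - L 1 (fst i) * \<gamma> 1 (snd i) (fst i)) + R * \<theta>"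
        using box[OF b] budget[OF b] eq1 nonneg \<theta>
        by (intro knapsack_weak_duality) (auto simp: case_prod_beta)
      moreover have "(\<Sum>(m, k)\<in>I. \<upsilon> (m, k) * dt * b (0, k, m))
          \<le> (\<Sum>(m, k)\<in>I. U 0 m * \<beta> 0 k m - L 0 m * \<gamma> 0 k m)"
      proof (intro sum_mono, clarify)
        fix m k assume mk: "(m, k) \<in> I"
        have "(\<beta> 0 k m - \<gamma> 0 k m) * b (0, k, m) \<le> U 0 m * \<beta> 0 k m - L 0 m * \<gamma> 0 k m"
          using nonneg[OF mk] box[OF b _ mk, of 0] by (intro box_weak_duality) auto
        then show "\<upsilon> (m, k) * dt * b (0, k, m) \<le> U 0 m * \<beta> 0 k m - L 0 m * \<gamma> 0 k m"
          using eq0[OF mk] by (simp add: algebra_simps)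
      qed
      ultimately show "dt * (\<Sum>k=1..M. \<Sum>m\<in>P. \<upsilon> (m, k) * (b (1, k, m) * N k + b (0, k, m))) \<le> E"
        using bound unfolding objective dual_objective by linarith
    qed
  next
    assume primal: ?primal
    from nonempty obtain b0 where b0: "b0 \<in> uncertainty_set P M dt T L U \<sigma>" by blast
    have LU: "L \<tau> m \<le> U \<tau> m" if "\<tau> \<in> {0, 1}" "(m, k) \<in> I" for \<tau> m k
      using box[OF b0 that] by linarith
    have "(\<Sum>i\<in>I. L 1 (fst i)) \<le> (\<Sum>(m, k)\<in>I. b0 (1, k, m))"
      using box[OF b0, of 1] by (intro sum_mono) auto
    then have feasible: "(\<Sum>i\<in>I. L 1 (fst i)) \<le> R" using budget[OF b0] by linarith
    have LU1: "L 1 (fst i) \<le> U 1 (fst i)" if "i \<in> I" for i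
      using LU[of 1 "fst i" "snd i"] that by simp
    obtain x \<theta> where \<theta>: "\<theta> \<ge> 0"
      and x: "\<forall>i\<in>I. L 1 (fst i) \<le> x i \<and> x i \<le> U 1 (fst i)"
      and x_budget: "sum x I \<le> R"
      and x_value: "(\<Sum>i\<in>I. U 1 (fst i) * max (c i - \<theta>) 0 - L 1 (fst i) * max (\<theta> - c i) 0) + R * \<theta>
        = (\<Sum>i\<in>I. c i * x i)"
      by (rule knapsack_strong_duality[OF finI LU1 feasible, of c]) (assumption | rule that)+
    define b :: "nat \<times> nat \<times> 'm \<Rightarrow> real" where
      "b = restrict (\<lambda>(\<tau>, k, m). if \<tau> = 1 then x (m, k) else U 0 m) (box_index P M)"
    have b1: "b (1, k, m) = x (m, k)" and b0_eq: "b (0, k, m) = U 0 m" if "(m, k) \<in> I" for m k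
      using that by (auto simp: b_def box_index_def I_def)
    have "b \<in> uncertainty_set P M dt T L U \<sigma>"
      unfolding set_iff
    proof (intro conjI)
      show "b \<in> box_index P M \<rightarrow>\<^sub>E UNIV" by (simp add: b_def)
      show "\<forall>\<tau>\<in>{0, 1}. \<forall>k\<in>{1..M}. \<forall>m\<in>P. L \<tau> m \<le> b (\<tau>, k, m) \<and> b (\<tau>, k, m) \<le> U \<tau> m"
        using x b1 b0_eq LU by (fastforce simp: I_def)
      have "(\<Sum>m\<in>P. \<Sum>k=1..M. b (1, k, m)) = sum x I"
        unfolding sum.cartesian_product I_def[symmetric] using b1 by (intro sum.cong) auto
      then show "(\<Sum>m\<in>P. \<Sum>k=1..M. b (1, k, m)) \<le> real M * (\<Sum>m\<in>P. U 1 m) / \<sigma>"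
        using x_budget by (simp add: R_def)
    qed
    then have "(\<Sum>i\<in>I. c i * b (1, snd i, fst i)) + (\<Sum>(m, k)\<in>I. \<upsilon> (m, k) * dt * b (0, k, m)) \<le> E"
      using primal unfolding objective by blast
    moreover have "(\<Sum>i\<in>I. c i * b (1, snd i, fst i)) = (\<Sum>i\<in>I. c i * x i)"
      using b1 by (intro sum.cong) auto
    moreover have "(\<Sum>(m, k)\<in>I. \<upsilon> (m, k) * dt * b (0, k, m)) = (\<Sum>(m, k)\<in>I. U 0 m * (\<upsilon> (m, k) * dt))"
      using b0_eq by (intro sum.cong) auto
    ultimately have dual_value: "(\<Sum>i\<in>I. U 1 (fst i) * max (c i - \<theta>) 0 - L 1 (fst i) * max (\<theta> - c i) 0)
        + (\<Sum>(m, k)\<in>I. U 0 m * (\<upsilon> (m, k) * dt)) + R * \<theta> \<le> E"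
      using x_value by linarith
    define \<beta> where "\<beta> \<tau> k m = (if \<tau> = 1 then max (c (m, k) - \<theta>) 0 else \<upsilon> (m, k) * dt)" for \<tau> :: nat and k m
    define \<gamma> where "\<gamma> \<tau> k m = (if \<tau> = 1 then max (\<theta> - c (m, k)) 0 else 0)" for \<tau> :: nat and k m
    show ?dual
    proof (rule exI[of _ \<beta>], rule exI[of _ \<gamma>], rule exI[of _ \<theta>], intro conjI ballI)
      show "(\<Sum>m\<in>P. \<Sum>k=1..M. - L 1 m * \<gamma> 1 k m + U 1 m * \<beta> 1 k m
                              + U 0 m * \<beta> 0 k m - L 0 m * \<gamma> 0 k m)
            + real M * (\<Sum>m\<in>P. U 1 m) / \<sigma> * \<theta> \<le> E"
        unfolding dual_objective R_def[symmetric] using dual_value by (simp add: \<beta>_def \<gamma>_def)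
    qed (use \<theta> \<upsilon> dt in \<open>auto simp: \<beta>_def \<gamma>_def c_def\<close>)
  qed
qed

theorem theorem4p5:
  fixes P :: "'m set" and M :: nat and dt T E \<sigma> :: real
    and L U :: "nat \<Rightarrow> 'm \<Rightarrow> real"
    and N :: "nat \<Rightarrow> real"
  assumes "finite P" and "P \<noteq> {}"
    and "M \<ge> 1" and "dt > 0" and "T = real M * dt"
    and "\<forall>\<tau>\<in>{0, 1}. \<forall>m\<in>P. L \<tau> m < U \<tau> m"
    and "\<sigma> \<ge> 1"
    and "box_topology P M interior_of uncertainty_set P M dt T L U \<sigma> \<noteq> {}"
  shows
    "(\<forall>b\<in>uncertainty_set P M dt T L U \<sigma>.
        dt * (\<Sum>k=1..M. Max ((\<lambda>m. b (1, k, m) * N k + b (0, k, m)) ` P)) \<le> E)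
     \<longleftrightarrow>
     (\<forall>\<upsilon>\<in>selection_matrices P M.
        \<exists>(\<beta> :: nat \<Rightarrow> nat \<Rightarrow> 'm \<Rightarrow> real) (\<gamma> :: nat \<Rightarrow> nat \<Rightarrow> 'm \<Rightarrow> real) (\<theta> :: real).
          (\<Sum>m\<in>P. \<Sum>k=1..M. - L 1 m * \<gamma> 1 k m + U 1 m * \<beta> 1 k m
                              + U 0 m * \<beta> 0 k m - L 0 m * \<gamma> 0 k m)
            + real M * (\<Sum>m\<in>P. U 1 m) / \<sigma> * \<theta> \<le> E \<and>
          (\<forall>k\<in>{1..M}. \<forall>m\<in>P. - \<gamma> 1 k m + \<beta> 1 k m + \<theta> = N k * \<upsilon> (m, k) * dt) \<and>
          (\<forall>k\<in>{1..M}. \<forall>m\<in>P. - \<gamma> 0 k m + \<beta> 0 k m = \<upsilon> (m, k) * dt) \<and>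
          (\<forall>k\<in>{1..M}. \<forall>m\<in>P. \<gamma> 1 k m \<ge> 0 \<and> \<beta> 1 k m \<ge> 0 \<and> \<gamma> 0 k m \<ge> 0 \<and> \<beta> 0 k m \<ge> 0) \<and>
          \<theta> \<ge> 0)"
proof -
  have nonempty: "uncertainty_set P M dt T L U \<sigma> \<noteq> {}"
    using assms(8) interior_of_subset[of "box_topology P M" "uncertainty_set P M dt T L U \<sigma>"]
    by blast
  have swap: "(\<forall>b\<in>uncertainty_set P M dt T L U \<sigma>.
        dt * (\<Sum>k=1..M. Max ((\<lambda>m. b (1, k, m) * N k + b (0, k, m)) ` P)) \<le> E)
     \<longleftrightarrow> (\<forall>\<upsilon>\<in>selection_matrices P M. \<forall>b\<in>uncertainty_set P M dt T L U \<sigma>.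
        dt * (\<Sum>k=1..M. \<Sum>m\<in>P. \<upsilon> (m, k) * (b (1, k, m) * N k + b (0, k, m))) \<le> E)"
    using sum_Max_le_iff_all_selections[OF assms(1,2) less_imp_le[OF assms(4)],
        where f = "\<lambda>k m. b (1, k, m) * N k + b (0, k, m)" for b :: "nat \<times> nat \<times> 'm \<Rightarrow> real"]
    by blast
  show ?thesis
    unfolding swap
    by (intro ball_cong refl
        robust_linear_constraint_iff_dual[OF assms(1,4,5) nonempty selection_nonneg])
qed

end
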